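(* Let $S\subseteq\mathbb{N}\times\mathbb{N}$ with $(0,0)\notin S$. Assume that $S$ satisfies the slope condition for the boundary $(i+1)_{i\ge 0}=(1,2,3,\ldots)$ and that $S$ contains either all proper horizontal steps $(a,0)$, $a>0$, or exactly one horizontal step $(1,0)$. If the generating function $A(x,y)$ is rational and $T(t)$ is algebraic, then the generating function $P(t)$ for Catalan $S$-paths is algebraic.
   Context: $\mathbb{N}$ is the set of non-negative integers. An $S$-path from $(0,0)$ to $(n,m)$ is a finite (possibly empty) sequence of steps in $S$ summing to $(n,m)$. Its nodes are $(0,0)$ and the points reached after each step. Let $\underline{s}=(s_i)_{i\ge 0}$ be a non-decreasing sequence of positive integers. $S$ satisfies the slope condition for the boundary $\underline{s}$ if for every $(a,b)\in S$ with $b\ne 0$ and every index $i\ge 0$, $s_{i+j}>s_i-1+ja/b$ for all $j=1,\ldots,b$. An $S$-path from $(0,0)$ is Catalan if it has right boundary $(i+1)_{i\ge0}$, i.e. every node $(x,y)$ satisfies $x<y+1$. $A(x,y)=\sum_{n,m\ge 0}a_{n,m}x^ny^m=\bigl(1-\sum_{(a,b)\in S}x^ay^b\bigr)^{-1}$, where $a_{n,m}$ is the number of $S$-paths from $(0,0)$ to $(n,m)$. $T(t)=\sum_{a\in I}t^a$ with $I=\{a:(a,a)\in S\}$. $P(t)=\sum_{n\ge 0}p_nt^n$, where $p_n$ is the number of Catalan $S$-paths from $(0,0)$ to $(n,n)$. A formal power series in $t$ is algebraic if it is algebraic over the field $\mathbb{Q}(t)$ of rational functions. *)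

theory Defs
  imports
    "HOL-Computational_Algebra.Computational_Algebra"
    "HOL-Library.Product_Plus"
begin

type_synonym step = "nat \<times> nat"

definition paths :: "step set \<Rightarrow> nat \<times> nat \<Rightarrow> step list set" where
  "paths S z = {w. set w \<subseteq> S \<and> sum_list w = z}"

definition nodes :: "step list \<Rightarrow> (nat \<times> nat) set" where
  "nodes w = {sum_list (take k w) |k. k \<le> length w}"

text \<open>A boundary is a non-decreasing sequence of positive integers \<open>s\<close>; only
  \<open>catalan_boundary\<close> is used below.\<close>

definition has_right_boundary :: "(nat \<Rightarrow> nat) \<Rightarrow> step list \<Rightarrow> bool" where
  "has_right_boundary s w \<longleftrightarrow> (\<forall>(x, y) \<in> nodes w. x < s y)"

definition slope_condition :: "step set \<Rightarrow> (nat \<Rightarrow> nat) \<Rightarrow> bool" where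
  "slope_condition S s \<longleftrightarrow>
     (\<forall>(a, b) \<in> S. b \<noteq> 0 \<longrightarrow>
        (\<forall>i. \<forall>j \<in> {1..b}. rat_of_nat (s (i + j)) >
           rat_of_nat (s i) - 1 + rat_of_nat j * rat_of_nat a / rat_of_nat b))"

definition catalan_boundary :: "nat \<Rightarrow> nat" where
  "catalan_boundary i = i + 1"

definition catalan_paths :: "step set \<Rightarrow> nat \<times> nat \<Rightarrow> step list set" where
  "catalan_paths S z = {w \<in> paths S z. has_right_boundary catalan_boundary w}"

text \<open>Both sets of paths are finite when \<open>(0, 0) \<notin> S\<close>, so that \<^const>\<open>card\<close>
  counts them in the generating functions below.\<close>

lemma finite_paths:
  assumes "(0, 0) \<notin> S"
  shows "finite (paths S (n, m))"
proof -
  have *: "set w \<subseteq> {..fst (sum_list w)} \<times> {..snd (sum_list w)} \<and>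
      length w \<le> fst (sum_list w) + snd (sum_list w)"
    if "set w \<subseteq> S" for w :: "step list"
    using that
  proof (induction w)
    case Nil
    then show ?case by simp
  next
    case (Cons z w)
    obtain a b where z: "z = (a, b)" by force
    with Cons.prems assms have "a + b \<ge> 1" by (cases a; cases b) auto
    with Cons z show ?case by fastforce
  qed
  have "paths S (n, m) \<subseteq> {w. set w \<subseteq> {..n} \<times> {..m} \<and> length w \<le> n + m}"
    using * by (fastforce simp: paths_def)
  then show ?thesis
    by (rule finite_subset) (intro finite_lists_length_le; simp)
qed

lemma finite_catalan_paths: "(0, 0) \<notin> S \<Longrightarrow> finite (catalan_paths S (n, m))"
  by (simp add: catalan_paths_def finite_paths)

text \<open>Bivariate series are elements of \<open>\<rat>[[y]][[x]]\<close>: the coefficient of \<open>x\<^sup>n y\<^sup>m\<close>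
  in \<open>F\<close> is \<open>F $ n $ m\<close>. Likewise \<open>\<rat>[x, y]\<close> is represented as \<open>\<rat>[y][x]\<close>.\<close>

definition A_series :: "step set \<Rightarrow> rat fps fps" where
  "A_series S = Abs_fps (\<lambda>n. Abs_fps (\<lambda>m. of_nat (card (paths S (n, m)))))"

definition T_series :: "step set \<Rightarrow> rat fps" where
  "T_series S = Abs_fps (\<lambda>a. if (a, a) \<in> S then 1 else 0)"

definition P_series :: "step set \<Rightarrow> rat fps" where
  "P_series S = Abs_fps (\<lambda>n. of_nat (card (catalan_paths S (n, n))))"

definition fps2_of_poly :: "rat poly poly \<Rightarrow> rat fps fps" where
  "fps2_of_poly p = fps_of_poly (map_poly fps_of_poly p)"

definition rational_fps2 :: "rat fps fps \<Rightarrow> bool" where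
  "rational_fps2 F \<longleftrightarrow> (\<exists>p q. q \<noteq> 0 \<and> fps2_of_poly q * F = fps2_of_poly p)"

text \<open>The field \<open>\<rat>(t)\<close>, as a subfield of the field of Laurent series \<open>\<rat>((t))\<close>,
  which also contains \<open>\<rat>[[t]]\<close>.\<close>

definition rational_functions :: "rat fls set" where
  "rational_functions =
     {fps_to_fls (fps_of_poly p) / fps_to_fls (fps_of_poly q) |p q. q \<noteq> 0}"

definition algebraic_fps :: "rat fps \<Rightarrow> bool" where
  "algebraic_fps f \<longleftrightarrow>
     (\<exists>F :: rat fls poly. (\<forall>i. coeff F i \<in> rational_functions) \<and> F \<noteq> 0 \<and>
        poly F (fps_to_fls f) = 0)"

end

theory Submission
  imports "HOL-Algebra.Algebraic_Closure_Type" Defs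
begin

text \<open>
  Give a node \<open>(x, y)\<close> the height \<open>y - x\<close>. By the slope condition every step \<open>(a, b)\<close> with \<open>b \<noteq> 0\<close> has
  \<open>a \<le> b\<close>, so only horizontal steps descend. Let \<open>G\<^sub>k(t)\<close> count the paths from height \<open>k\<close> to height
  \<open>0\<close> that never go below \<open>0\<close>, with \<open>t\<close> marking the gain in \<open>y\<close>; then \<open>P = G\<^sub>0\<close>. Put \<open>\<delta> = 1\<close> if all
  \<open>(a, 0)\<close> are steps and \<open>\<delta> = 0\<close> if only \<open>(1, 0)\<close> is, and let \<open>N(x, y)\<close> be the generating function of the
  non-horizontal steps. Splitting off the first step, and in the case \<open>\<delta> = 1\<close> taking differences, yields
  a recurrence for \<open>G\<close> whose solutions are determined by one initial value. Hence \<open>G\<^sub>1, G\<^sub>2, \<dots>\<close> is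
  geometric, with a ratio \<open>z\<close> satisfying \<open>z = 1 + \<delta> + (z - \<delta>) N(1/z, tz)\<close>, and
  \<open>P (1 + \<delta> - \<delta>T) = z\<close>. The equation for \<open>z\<close> says that \<open>(1 - \<delta>x)/A(x, y)\<close> vanishes at
  \<open>x = 1/z\<close>, \<open>y = tz\<close>. If \<open>A = p/q\<close>, then so does \<open>q\<close>, and the monomials in \<open>1/z\<close> and \<open>tz\<close> being distinct,
  this is a non-trivial polynomial equation for \<open>z\<close> over \<open>\<rat>(t)\<close>.
\<close>

section \<open>Algebraic power series\<close>

lemma rational_functionsE:
  assumes "r \<in> rational_functions"
  obtains p q where "q \<noteq> 0"
    "r = fps_to_fls (fps_of_poly p) / fps_to_fls (fps_of_poly q)"
  using assms by (auto simp: rational_functions_def)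

lemma rational_functionsI:
  "q \<noteq> 0 \<Longrightarrow> fps_to_fls (fps_of_poly p) / fps_to_fls (fps_of_poly q) \<in> rational_functions"
  by (auto simp: rational_functions_def)

lemma fps_of_poly_in_rational_functions: "fps_to_fls (fps_of_poly p) \<in> rational_functions"
  using rational_functionsI[of 1 p] by simp

lemma rational_functions_minus: "r \<in> rational_functions \<Longrightarrow> - r \<in> rational_functions"
  by (elim rational_functionsE) (metis fps_of_poly_uminus fps_to_fls_uminus
      minus_divide_left rational_functionsI)

lemma rational_functions_add:
  assumes "r \<in> rational_functions" "s \<in> rational_functions"
  shows "r + s \<in> rational_functions"
proof -
  obtain p q where r: "q \<noteq> 0" "r = fps_to_fls (fps_of_poly p) / fps_to_fls (fps_of_poly q)"
    using assms(1) by (rule rational_functionsE)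
  obtain p' q' where s: "q' \<noteq> 0" "s = fps_to_fls (fps_of_poly p') / fps_to_fls (fps_of_poly q')"
    using assms(2) by (rule rational_functionsE)
  have "r + s = fps_to_fls (fps_of_poly (p * q' + p' * q)) / fps_to_fls (fps_of_poly (q * q'))"
    using r s by (simp add: fps_of_poly_add fps_of_poly_mult fls_times_fps_to_fls
        add_divide_eq_iff divide_add_eq_iff field_simps)
  then show ?thesis
    using r s rational_functionsI[of "q * q'" "p * q' + p' * q"] by simp
qed

lemma rational_functions_mult:
  assumes "r \<in> rational_functions" "s \<in> rational_functions"
  shows "r * s \<in> rational_functions"
proof -
  obtain p q where r: "q \<noteq> 0" "r = fps_to_fls (fps_of_poly p) / fps_to_fls (fps_of_poly q)"
    using assms(1) by (rule rational_functionsE)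
  obtain p' q' where s: "q' \<noteq> 0" "s = fps_to_fls (fps_of_poly p') / fps_to_fls (fps_of_poly q')"
    using assms(2) by (rule rational_functionsE)
  have "r * s = fps_to_fls (fps_of_poly (p * p')) / fps_to_fls (fps_of_poly (q * q'))"
    using r s by (simp add: fps_of_poly_mult fls_times_fps_to_fls)
  then show ?thesis
    using r s rational_functionsI[of "q * q'" "p * p'"] by simp
qed

lemma rational_functions_inverse:
  assumes "r \<in> rational_functions"
  shows "inverse r \<in> rational_functions"
proof -
  obtain p q where r: "q \<noteq> 0" "r = fps_to_fls (fps_of_poly p) / fps_to_fls (fps_of_poly q)"
    using assms by (rule rational_functionsE)
  show ?thesis
  proof (cases "p = 0")
    case True
    then show ?thesis using r assms by simp
  next
    case False
    then show ?thesis using r rational_functionsI[of p q] by simp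
  qed
qed

section \<open>Laurent series as a record-based field, so that the theory of field extensions
  applies\<close>

abbreviation laurent_field :: "rat fls ring" where
  "laurent_field \<equiv> ring_of_type_algebra"

lemma laurent_field_simps [simp]:
  "carrier laurent_field = UNIV" "x \<otimes>\<^bsub>laurent_field\<^esub> y = x * y"
  "x \<oplus>\<^bsub>laurent_field\<^esub> y = x + y" "\<one>\<^bsub>laurent_field\<^esub> = 1" "\<zero>\<^bsub>laurent_field\<^esub> = 0"
  by (simp_all add: ring_of_type_algebra_def)

lemma laurent_field_pow [simp]: "x [^]\<^bsub>laurent_field\<^esub> (n::nat) = x ^ n"
  by (induction n) (simp_all add: mult.commute)

lemma laurent_field_minus [simp]: "\<ominus>\<^bsub>laurent_field\<^esub> x = - x"
  by (rule abelian_group.minus_equality[OF ring.is_abelian_group[OF ring_from_type_algebra]]) simp_all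

lemma laurent_field_inv: "x \<noteq> 0 \<Longrightarrow> inv\<^bsub>laurent_field\<^esub> x = inverse x"
  by (rule comm_monoid.comm_inv_char[OF cring.axioms(2)[OF cring_from_type_algebra]]) simp_all

lemma subfield_rational_functions: "subfield rational_functions laurent_field"
proof -
  interpret laurent: field laurent_field by (rule field_from_type_algebra)
  have "\<one>\<^bsub>laurent_field\<^esub> \<in> rational_functions"
    using fps_of_poly_in_rational_functions[of 1] by simp
  then show ?thesis
    by (intro laurent.subfieldI' laurent.subringI)
      (auto simp: laurent_field_inv rational_functions_minus rational_functions_add
        rational_functions_mult rational_functions_inverse)
qed

text \<open>Polynomials over a ring record are coefficient lists with the leading coefficient first,
  whereas \<open>Poly\<close> starts with the constant one; hence \<open>rev\<close>.\<close>

lemma laurent_eval: "ring.eval laurent_field (rev cs) x = poly (Poly cs) x"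
proof (induction cs rule: rev_induct)
  case Nil
  interpret laurent: field laurent_field by (rule field_from_type_algebra)
  show ?case by simp
next
  case (snoc c cs)
  interpret laurent: field laurent_field by (rule field_from_type_algebra)
  show ?case using snoc by (simp add: Poly_append poly_monom algebra_simps)
qed

abbreviation laurent_algebraic :: "rat fls \<Rightarrow> bool" where
  "laurent_algebraic x \<equiv> \<not> ring.transcendental laurent_field rational_functions x"

text \<open>Reversed coefficient lists translate witnesses both ways. A record polynomial is the
  empty list or has a nonzero head, so nonempty lists match nonzero polynomials.\<close>

lemma algebraic_fps_iff:
  "algebraic_fps f \<longleftrightarrow> laurent_algebraic (fps_to_fls f)"
proof -
  interpret laurent: field laurent_field by (rule field_from_type_algebra)
  show ?thesis
  proof
    assume "algebraic_fps f"
    then obtain F :: "rat fls poly" where F: "\<And>i. Polynomial.coeff F i \<in> rational_functions"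
      "F \<noteq> 0" "poly F (fps_to_fls f) = 0"
      by (auto simp: algebraic_fps_def)
    have "(laurent.algebraic over rational_functions) (fps_to_fls f)"
    proof (rule laurent.algebraicI)
      show "rev (coeffs F) \<in> carrier (univ_poly laurent_field rational_functions)"
        using F(1,2) by (auto simp: univ_poly_def polynomial_def hd_rev last_coeffs_eq_coeff_degree
            coeffs_def)
      show "rev (coeffs F) \<noteq> []" using F(2) by simp
      show "laurent.eval (rev (coeffs F)) (fps_to_fls f) = \<zero>\<^bsub>laurent_field\<^esub>"
        using F(3) by (simp add: laurent_eval)
    qed
    then show "laurent.algebraic rational_functions (fps_to_fls f)"
      by (simp add: over_def)
  next
    assume "laurent.algebraic rational_functions (fps_to_fls f)"
    then obtain p where p: "p \<in> carrier (univ_poly laurent_field rational_functions)"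
      "p \<noteq> []" "laurent.eval p (fps_to_fls f) = 0"
      using laurent.algebraicE[OF subfieldE(1)[OF subfield_rational_functions], of "fps_to_fls f"]
      by (auto simp: over_def)
    let ?F = "Poly (rev p)"
    have set: "set p \<subseteq> rational_functions" and hd: "hd p \<noteq> 0"
      using p by (auto simp: univ_poly_def polynomial_def)
    have "0 \<in> rational_functions"
      using fps_of_poly_in_rational_functions[of 0] by simp
    then have "Polynomial.coeff ?F i \<in> rational_functions" for i
      using set nth_mem[of i "rev p"] by (auto simp: nth_default_def simp del: nth_mem)
    moreover have "?F \<noteq> 0"
    proof
      assume "?F = 0"
      then have "set (rev p) \<subseteq> {0}"
        by (metis Poly_eq_0 set_replicate_conv_if singletonI subset_singletonD
            subsetI empty_subsetI equalityD1)
      then show False using p(2) hd by (metis hd_in_set set_rev singletonD subsetD)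
    qed
    moreover have "poly ?F (fps_to_fls f) = 0"
      using p(3) laurent_eval[of "rev p" "fps_to_fls f"] by simp
    ultimately show "algebraic_fps f"
      unfolding algebraic_fps_def by blast
  qed
qed

text \<open>The closure of \<open>algebraic_fps\<close> under the field operations is read off from
  this subfield.\<close>

lemma subfield_algebraics:
  "subfield {x. laurent_algebraic x} laurent_field"
  using field.subfield_of_algebraics[OF field_from_type_algebra subfield_rational_functions]
  by (simp add: over_def)

lemma algebraic_fps_of_poly: "algebraic_fps (fps_of_poly p)"
  unfolding algebraic_fps_iff
  using domain.algebraic_self[OF field.axioms(1)[OF field_from_type_algebra]
      subfieldE(1)[OF subfield_rational_functions]
      fps_of_poly_in_rational_functions] by (simp add: over_def)

lemma algebraic_fps_const: "algebraic_fps (fps_const c)"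
  using algebraic_fps_of_poly[of "[:c:]"] by (simp add: fps_of_poly_const)

lemma algebraic_fps_mult:
  "algebraic_fps f \<Longrightarrow> algebraic_fps g \<Longrightarrow> algebraic_fps (f * g)"
  using subringE(6)[OF subfieldE(1)[OF subfield_algebraics]]
  by (simp add: algebraic_fps_iff fls_times_fps_to_fls)

lemma algebraic_fps_add:
  "algebraic_fps f \<Longrightarrow> algebraic_fps g \<Longrightarrow> algebraic_fps (f + g)"
  using subringE(7)[OF subfieldE(1)[OF subfield_algebraics]]
  by (simp add: algebraic_fps_iff)

lemma algebraic_fps_uminus: "algebraic_fps f \<Longrightarrow> algebraic_fps (- f)"
  using subringE(5)[OF subfieldE(1)[OF subfield_algebraics]]
  by (simp add: algebraic_fps_iff)

lemma algebraic_fps_diff: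
  "algebraic_fps f \<Longrightarrow> algebraic_fps g \<Longrightarrow> algebraic_fps (f - g)"
  using algebraic_fps_add[OF _ algebraic_fps_uminus] by fastforce

text \<open>A nonzero constant term makes the inverse as a power series agree with the inverse in
  the Laurent field.\<close>

lemma algebraic_fps_inverse:
  assumes "algebraic_fps f" "f $ 0 \<noteq> 0"
  shows "algebraic_fps (inverse f)"
proof -
  have "f \<noteq> 0" using assms(2) by auto
  then have "inverse (fps_to_fls f) \<in> {x. laurent_algebraic x}"
    using ring.subfield_m_inv(1)[OF ring_from_type_algebra subfield_algebraics, of "fps_to_fls f"] assms(1)
    by (simp add: algebraic_fps_iff laurent_field_inv)
  then show ?thesis
    using assms(2) by (simp add: algebraic_fps_iff fls_inverse_fps_to_fls)
qed

section \<open>The kernel substitution\<close>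

text \<open>The substitution \<open>y = t\<close> in a series in \<open>y\<close> whose coefficients are series in \<open>t\<close>.\<close>

definition diag :: "'a::comm_ring_1 fps fps \<Rightarrow> 'a fps" where
  "diag U = Abs_fps (\<lambda>n. \<Sum>b\<le>n. U $ b $ (n - b))"

lemma diag_nth: "diag U $ n = (\<Sum>b\<le>n. U $ b $ (n - b))"
  by (simp add: diag_def)

lemma diag_add: "diag (U + V) = diag U + diag V"
  by (rule fps_ext) (simp add: diag_nth sum.distrib)

lemma diag_diff: "diag (U - V) = diag U - diag V"
  by (rule fps_ext) (simp add: diag_nth sum_subtractf)

lemma diag_const: "diag (fps_const f) = f"
proof (rule fps_ext)
  fix n
  have "diag (fps_const f) $ n = (\<Sum>b\<le>n. if b = 0 then f $ n else 0)"
    unfolding diag_nth by (intro sum.cong) auto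
  then show "diag (fps_const f) $ n = f $ n" by simp
qed

text \<open>Both sides sum products of a coefficient of \<open>U\<close> and one of \<open>V\<close>
  over all exponents of total degree \<open>n\<close>. The left side groups them by the power of y,
  the right side by the degree \<open>m\<close> that \<open>U\<close> contributes.\<close>

lemma diag_mult: "diag (U * V) = diag U * diag V"
proof (rule fps_ext)
  fix n
  have "diag (U * V) $ n =
      (\<Sum>b\<le>n. \<Sum>i\<le>b. \<Sum>k\<le>n - b. U $ i $ k * V $ (b - i) $ (n - b - k))"
    by (simp add: diag_nth fps_mult_nth fps_sum_nth atLeast0AtMost)
  also have "\<dots> = (\<Sum>(b, i, k)\<in>Sigma {..n} (\<lambda>b. {..b} \<times> {..n - b}).
      U $ i $ k * V $ (b - i) $ (n - b - k))"
    by (simp add: sum.Sigma sum.cartesian_product)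
  also have "\<dots> = (\<Sum>(m, i, j)\<in>Sigma {..n} (\<lambda>m. {..m} \<times> {..n - m}).
      U $ i $ (m - i) * V $ j $ (n - m - j))"
  proof (rule sum.reindex_bij_witness[where i = "\<lambda>(m, i, j). (i + j, i, m - i)"
        and j = "\<lambda>(b, i, k). (i + k, i, b - i)"])
    fix t assume "t \<in> Sigma {..n} (\<lambda>b. {..b} \<times> {..n - b})"
    then obtain b i k where t: "t = (b, i, k)" "b \<le> n" "i \<le> b" "k \<le> n - b" by auto
    then have "n - (i + k) - (b - i) = n - b - k" by simp
    with t show "(case case t of (b, i, k) \<Rightarrow> (i + k, i, b - i) of
          (m, i, j) \<Rightarrow> U $ i $ (m - i) * V $ j $ (n - m - j)) =
        (case t of (b, i, k) \<Rightarrow> U $ i $ k * V $ (b - i) $ (n - b - k))"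
      by simp
  qed auto
  also have "\<dots> = (\<Sum>m\<le>n. \<Sum>i\<le>m. \<Sum>j\<le>n - m. U $ i $ (m - i) * V $ j $ (n - m - j))"
    by (simp add: sum.Sigma sum.cartesian_product)
  also have "\<dots> = (diag U * diag V) $ n"
    by (simp add: diag_nth fps_mult_nth atLeast0AtMost sum_product)
  finally show "diag (U * V) $ n = (diag U * diag V) $ n" .
qed

lemma diag_Abs_fps_finite:
  assumes "\<And>b. b > B \<Longrightarrow> U b = 0"
  shows "diag (Abs_fps U) = (\<Sum>b\<le>B. fps_X ^ b * U b)"
proof (rule fps_ext)
  fix n
  have "(\<Sum>b\<le>B. fps_X ^ b * U b) $ n = (\<Sum>b\<le>B. if n < b then 0 else U b $ (n - b))"
    by (simp add: fps_sum_nth fps_X_power_mult_nth)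
  also have "\<dots> = (\<Sum>b\<in>{..n} \<inter> {..B}. if n < b then 0 else U b $ (n - b))"
    by (rule sum.mono_neutral_right) auto
  also have "\<dots> = (\<Sum>b\<le>n. U b $ (n - b))"
    using assms by (intro sum.mono_neutral_cong_left) (auto, metis fps_zero_nth not_le)
  finally show "diag (Abs_fps U) $ n = (\<Sum>b\<le>B. fps_X ^ b * U b) $ n"
    by (simp add: diag_nth)
qed

text \<open>The substitution x = 1/z, y = tz turns x^a y^b into t^b z^(b - a), so \<open>d\<close>
  bounds the negative powers of z.\<close>

definition xbounded :: "nat \<Rightarrow> 'a::zero fps fps \<Rightarrow> bool" where
  "xbounded d F \<longleftrightarrow> (\<forall>a b. a > b + d \<longrightarrow> F $ a $ b = 0)"

lemma xbounded_diff:
  "xbounded d F \<Longrightarrow> xbounded d G \<Longrightarrow> xbounded d (F - G)" for F :: "'a::comm_ring_1 fps fps"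
  by (simp add: xbounded_def)

lemma xbounded_mult:
  fixes F G :: "'a::comm_ring_1 fps fps"
  assumes "xbounded d F" "xbounded e G"
  shows "xbounded (d + e) (F * G)"
  unfolding xbounded_def
proof (intro allI impI)
  fix a b assume ab: "a > b + (d + e)"
  have "F $ i $ j * G $ (a - i) $ (b - j) = 0" if "j \<le> b" for i j
  proof -
    \<comment> \<open>The differences of the exponents add up to more than d + e, so one of the two
      exceeds its bound.\<close>
    have "i > j + d \<or> a - i > b - j + e" using ab that by linarith
    then show ?thesis using assms by (auto simp: xbounded_def)
  qed
  then show "(F * G) $ a $ b = 0"
    by (simp add: fps_mult_nth fps_sum_nth)
qed

text \<open>The substitution \<open>x = 1/z\<close>, \<open>y = tz\<close>, multiplied by \<open>z\<^sup>d\<close> so that only non-negative powers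
  of \<open>z\<close> occur; \<open>xbounded d F\<close> guarantees that no term of \<open>F\<close> is cut off by the range of \<open>a\<close>.\<close>

definition kernel_subst :: "nat \<Rightarrow> 'a::comm_ring_1 fps fps \<Rightarrow> 'a fps \<Rightarrow> 'a fps" where
  "kernel_subst d F z =
     diag (Abs_fps (\<lambda>b. \<Sum>a\<le>b + d. fps_const (F $ a $ b) * z ^ (b + d - a)))"

lemma kernel_subst_diff: "kernel_subst d (F - G) z = kernel_subst d F z - kernel_subst d G z"
  unfolding kernel_subst_def diag_diff[symmetric]
  by (rule arg_cong[where f = diag], rule fps_ext)
    (simp add: sum_subtractf left_diff_distrib flip: fps_const_sub)

text \<open>For polynomials f and g of degree at most D and E, this is the multiplicativity of the
  reflection z^D f(1/z), written without inverses.\<close>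

lemma reflected_product:
  fixes z :: "'a::comm_ring_1"
  assumes "\<And>i. i > D \<Longrightarrow> f i = 0" "\<And>i. i > E \<Longrightarrow> g i = 0"
  shows "(\<Sum>a\<le>D + E. (\<Sum>i\<le>a. f i * g (a - i)) * z ^ (D + E - a)) =
    (\<Sum>i\<le>D. f i * z ^ (D - i)) * (\<Sum>j\<le>E. g j * z ^ (E - j))"
proof -
  have "(\<Sum>a\<le>D + E. (\<Sum>i\<le>a. f i * g (a - i)) * z ^ (D + E - a)) =
      (\<Sum>(a, i)\<in>Sigma {..D + E} (\<lambda>a. {..a}). f i * g (a - i) * z ^ (D + E - a))"
    by (simp add: sum_distrib_right sum.Sigma)
  also have "\<dots> = (\<Sum>(a, i)\<in>{(a, i). i \<le> a \<and> i \<le> D \<and> a - i \<le> E}.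
      f i * g (a - i) * z ^ (D + E - a))"
  proof (rule sum.mono_neutral_right)
    show "\<forall>t\<in>Sigma {..D + E} (\<lambda>a. {..a}) - {(a, i). i \<le> a \<and> i \<le> D \<and> a - i \<le> E}.
        (case t of (a, i) \<Rightarrow> f i * g (a - i) * z ^ (D + E - a)) = 0"
    proof
      fix t assume "t \<in> Sigma {..D + E} (\<lambda>a. {..a}) - {(a, i). i \<le> a \<and> i \<le> D \<and> a - i \<le> E}"
      then obtain a i where t: "t = (a, i)" "i > D \<or> a - i > E" by fastforce
      then have "f i = 0 \<or> g (a - i) = 0" using assms by blast
      then show "(case t of (a, i) \<Rightarrow> f i * g (a - i) * z ^ (D + E - a)) = 0"
        using t by auto
    qed
  qed auto
  also have "\<dots> = (\<Sum>(i, j)\<in>{..D} \<times> {..E}. f i * z ^ (D - i) * (g j * z ^ (E - j)))"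
  proof (rule sum.reindex_bij_witness[where i = "\<lambda>(i, j). (i + j, i)" and j = "\<lambda>(a, i). (i, a - i)"])
    fix t assume "t \<in> {(a, i). i \<le> a \<and> i \<le> D \<and> a - i \<le> E}"
    then obtain a i where t: "t = (a, i)" "i \<le> a" "i \<le> D" "a - i \<le> E" by auto
    then have "D + E - a = (D - i) + (E - (a - i))" by simp
    then have "z ^ (D + E - a) = z ^ (D - i) * z ^ (E - (a - i))" by (metis power_add)
    then show "(case case t of (a, i) \<Rightarrow> (i, a - i) of (i, j) \<Rightarrow> f i * z ^ (D - i) * (g j * z ^ (E - j))) =
         (case t of (a, i) \<Rightarrow> f i * g (a - i) * z ^ (D + E - a))"
      using t by (simp add: mult_ac)
  qed auto
  also have "\<dots> = (\<Sum>i\<le>D. f i * z ^ (D - i)) * (\<Sum>j\<le>E. g j * z ^ (E - j))"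
    by (simp add: sum_product sum.cartesian_product)
  finally show ?thesis .
qed

lemma fps_const_sum: "fps_const (sum f A) = (\<Sum>x\<in>A. fps_const (f x))"
  by (rule fps_ext) (simp add: fps_sum_nth)

text \<open>As \<open>diag\<close> is multiplicative, it suffices to compare the coefficients of
  y^b. Each split of b into j and b - j gives reflected polynomials in x, multiplied by
  \<open>reflected_product\<close> with D = j + d and E = b - j + e.\<close>

lemma kernel_subst_mult:
  assumes F: "xbounded d F" and G: "xbounded e G"
  shows "kernel_subst (d + e) (F * G) z = kernel_subst d F z * kernel_subst e G z"
  unfolding kernel_subst_def diag_mult[symmetric]
proof (rule arg_cong[where f = diag], rule fps_ext)
  fix b
  let ?c = fps_const
  have *: "(\<Sum>a\<le>b + (d + e). (\<Sum>i\<le>a. ?c (F $ i $ j) * ?c (G $ (a - i) $ (b - j))) * z ^ (b + (d + e) - a)) =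
      (\<Sum>i\<le>j + d. ?c (F $ i $ j) * z ^ (j + d - i)) *
      (\<Sum>i\<le>b - j + e. ?c (G $ i $ (b - j)) * z ^ (b - j + e - i))" if "j \<le> b" for j
  proof -
    have "b + (d + e) = (j + d) + (b - j + e)" using that by simp
    then show ?thesis
      unfolding \<open>b + (d + e) = (j + d) + (b - j + e)\<close>
      using F G by (intro reflected_product) (auto simp: xbounded_def)
  qed
  have "(\<Sum>a\<le>b + (d + e). ?c ((F * G) $ a $ b) * z ^ (b + (d + e) - a)) =
      (\<Sum>a\<le>b + (d + e). \<Sum>j\<le>b. (\<Sum>i\<le>a. ?c (F $ i $ j) * ?c (G $ (a - i) $ (b - j))) * z ^ (b + (d + e) - a))"
  proof (rule sum.cong[OF refl])
    fix a
    have "?c ((F * G) $ a $ b) = (\<Sum>i\<le>a. \<Sum>j\<le>b. ?c (F $ i $ j) * ?c (G $ (a - i) $ (b - j)))"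
      by (simp add: fps_mult_nth fps_sum_nth atLeast0AtMost fps_const_sum)
    also have "\<dots> = (\<Sum>j\<le>b. \<Sum>i\<le>a. ?c (F $ i $ j) * ?c (G $ (a - i) $ (b - j)))"
      by (rule sum.swap)
    finally show "?c ((F * G) $ a $ b) * z ^ (b + (d + e) - a) =
        (\<Sum>j\<le>b. (\<Sum>i\<le>a. ?c (F $ i $ j) * ?c (G $ (a - i) $ (b - j))) * z ^ (b + (d + e) - a))"
      by (simp only: sum_distrib_right)
  qed
  also have "\<dots> = (\<Sum>j\<le>b. \<Sum>a\<le>b + (d + e). (\<Sum>i\<le>a. ?c (F $ i $ j) * ?c (G $ (a - i) $ (b - j))) * z ^ (b + (d + e) - a))"
    by (rule sum.swap)
  also have "\<dots> = (\<Sum>j\<le>b. (\<Sum>i\<le>j + d. ?c (F $ i $ j) * z ^ (j + d - i)) *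
      (\<Sum>i\<le>b - j + e. ?c (G $ i $ (b - j)) * z ^ (b - j + e - i)))"
    by (rule sum.cong[OF refl], rule *) simp
  finally show "Abs_fps (\<lambda>b. \<Sum>a\<le>b + (d + e). ?c ((F * G) $ a $ b) * z ^ (b + (d + e) - a)) $ b =
      (Abs_fps (\<lambda>b. \<Sum>a\<le>b + d. ?c (F $ a $ b) * z ^ (b + d - a)) *
       Abs_fps (\<lambda>b. \<Sum>a\<le>b + e. ?c (G $ a $ b) * z ^ (b + e - a))) $ b"
    by (simp add: fps_mult_nth atLeast0AtMost)
qed

lemma linear_nth: "(1 - fps_const c * fps_X) $ a = (if a = 0 then 1 else if a = 1 then - c else 0)"
  for c :: "'a::comm_ring_1"
  by (auto simp: fps_X_def)

lemma xbounded_linear: "xbounded 1 (1 - fps_const (fps_const c) * fps_X)"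
  for c :: "'a::comm_ring_1"
  unfolding xbounded_def linear_nth by auto

text \<open>This is z (1 - c/z); only the term b = 0 is nonzero.\<close>

lemma kernel_subst_linear:
  "kernel_subst 1 (1 - fps_const (fps_const c) * fps_X) z = z - fps_const c"
proof -
  have "Abs_fps (\<lambda>b. \<Sum>a\<le>b + 1. fps_const ((1 - fps_const (fps_const c) * fps_X) $ a $ b) *
      z ^ (b + 1 - a)) = fps_const (z - fps_const c)"
  proof (rule fps_ext)
    fix b
    show "Abs_fps (\<lambda>b. \<Sum>a\<le>b + 1. fps_const ((1 - fps_const (fps_const c) * fps_X) $ a $ b) *
      z ^ (b + 1 - a)) $ b = fps_const (z - fps_const c) $ b"
    proof (cases "b = 0")
      case True
      then show ?thesis by (simp add: linear_nth)
    next
      case False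
      then have "fps_const ((1 - fps_const (fps_const c) * fps_X) $ a $ b) = 0" for a
        by (simp add: linear_nth)
      then show ?thesis using False by simp
    qed
  qed
  then show ?thesis by (simp add: kernel_subst_def diag_const)
qed

section \<open>Polynomials under the kernel substitution\<close>

lemma fps2_of_poly_nth: "fps2_of_poly q $ a $ b = Polynomial.coeff (Polynomial.coeff q a) b"
  by (simp add: fps2_of_poly_def coeff_map_poly)

lemma xbounded_fps2_of_poly: "Polynomial.degree q \<le> d \<Longrightarrow> xbounded d (fps2_of_poly q)"
  by (auto simp: xbounded_def fps2_of_poly_nth coeff_eq_0)

lemma sum_in_rational_functions:
  "(\<And>x. x \<in> A \<Longrightarrow> f x \<in> rational_functions) \<Longrightarrow> sum f A \<in> rational_functions"
  using fps_of_poly_in_rational_functions[of 0]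
  by (induction A rule: infinite_finite_induct) (auto simp: rational_functions_add)

lemma fps_to_fls_sum: "fps_to_fls (sum f A) = (\<Sum>x\<in>A. fps_to_fls (f x))"
  by (induction A rule: infinite_finite_induct) simp_all

text \<open>The monomial x^a y^b becomes t^b z^(b + d - a), and since a \<le> d the two exponents
  determine a and b. So nothing cancels, and the vanishing of the substitution is a non-trivial
  polynomial equation for z over the rational functions.\<close>

lemma algebraic_fps_of_kernel_subst:
  assumes "q \<noteq> 0" "Polynomial.degree q \<le> d" "kernel_subst d (fps2_of_poly q) z = 0"
  shows "algebraic_fps z"
proof -
  let ?c = "\<lambda>a b. Polynomial.coeff (Polynomial.coeff q a) b"
  define B where "B = Max ((\<lambda>a. Polynomial.degree (Polynomial.coeff q a)) ` {..d})"
  have B: "?c a b = 0" if "b > B" for a b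
  proof (cases "a \<le> d")
    case True
    then have "Polynomial.degree (Polynomial.coeff q a) \<le> B"
      unfolding B_def by (intro Max_ge) auto
    then show ?thesis using that by (intro coeff_eq_0) simp
  next
    case False
    then show ?thesis using assms(2) by (simp add: coeff_eq_0)
  qed
  define r where "r = (\<lambda>a b. fps_to_fls (fps_of_poly (Polynomial.monom (?c a b) b)))"
  define F where "F = (\<Sum>b\<le>B. \<Sum>a\<le>d. Polynomial.monom (r a b) (b + d - a))"
  have coeff_F: "Polynomial.coeff F e = (\<Sum>b\<le>B. \<Sum>a\<le>d. if b + d - a = e then r a b else 0)" for e
    by (simp add: F_def coeff_sum)
  have "Polynomial.coeff F e \<in> rational_functions" for e
    unfolding coeff_F r_def using fps_of_poly_in_rational_functions[of 0]
    by (intro sum_in_rational_functions) (auto intro: fps_of_poly_in_rational_functions)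
  moreover have "F \<noteq> 0"
  proof -
    obtain a0 b0 where c0: "?c a0 b0 \<noteq> 0"
      using assms(1) by (metis poly_eq_iff coeff_0)
    have a0: "a0 \<le> d" using c0 assms(2) by (metis coeff_0 coeff_eq_0 le_trans not_le)
    have b0: "b0 \<le> B" using c0 B by (meson not_le)
    \<comment> \<open>In the coefficient of z^(b0 + d - a0), the power t^b0 singles out b = b0, and
      then a = a0.\<close>
    have "fls_nth (Polynomial.coeff F (b0 + d - a0)) (int b0) =
       (\<Sum>b\<le>B. \<Sum>a\<le>d. if a = a0 then if b = b0 then ?c a b else 0 else 0)"
      unfolding coeff_F fls_nth_sum
      using a0 by (intro sum.cong) (auto simp: r_def)
    also have "\<dots> = ?c a0 b0" using a0 b0 by simp
    finally show ?thesis using c0 by auto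
  qed
  moreover have "poly F (fps_to_fls z) = 0"
  proof -
    have "kernel_subst d (fps2_of_poly q) z =
        (\<Sum>b\<le>B. fps_X ^ b * (\<Sum>a\<le>b + d. fps_const (?c a b) * z ^ (b + d - a)))"
      unfolding kernel_subst_def fps2_of_poly_nth
      by (rule diag_Abs_fps_finite) (simp add: B)
    \<comment> \<open>Terms with d < a \<le> b + d vanish by the degree bound on
      \<open>q\<close>.\<close>
    also have "\<dots> = (\<Sum>b\<le>B. \<Sum>a\<le>d. fps_X ^ b * (fps_const (?c a b) * z ^ (b + d - a)))"
      unfolding sum_distrib_left
      using assms(2) by (intro sum.cong sum.mono_neutral_right) (auto simp: coeff_eq_0)
    also have "fps_to_fls \<dots> = poly F (fps_to_fls z)"
      by (simp add: F_def poly_sum poly_monom r_def fps_to_fls_sum fls_times_fps_to_fls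
          fps_to_fls_power fps_of_poly_monom mult_ac)
    finally show ?thesis using assms(3) by simp
  qed
  ultimately show ?thesis unfolding algebraic_fps_def by blast
qed

text \<open>The kernel is \<open>(1 - \<delta>x) (1 - \<Sum>x\<^sup>ay\<^sup>b)\<close>, where the factor \<open>1 - \<delta>x\<close> clears the denominator
  that the horizontal steps contribute.\<close>

lemma algebraic_fps_of_kernel:
  fixes A N :: "rat fps fps" and \<delta> :: rat
  defines "lin \<equiv> \<lambda>c. 1 - fps_const (fps_const c) * fps_X"
  assumes "rational_fps2 A" and N: "xbounded 0 N"
    and ker: "A * (lin (1 + \<delta>) - lin \<delta> * N) = lin \<delta>"
    and z: "z = fps_const (1 + \<delta>) + (z - fps_const \<delta>) * kernel_subst 0 N z"
      "z \<noteq> fps_const \<delta>"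
  shows "algebraic_fps z"
proof -
  obtain p q where q: "q \<noteq> 0" "fps2_of_poly q * A = fps2_of_poly p"
    using assms(2) by (auto simp: rational_fps2_def)
  define d where "d = max (Polynomial.degree p) (Polynomial.degree q)"
  let ?H = "lin (1 + \<delta>) - lin \<delta> * N"
  have lin: "xbounded 1 (lin c)" for c
    unfolding lin_def by (rule xbounded_linear)
  have lin_subst: "kernel_subst 1 (lin c) z = z - fps_const c" for c
    unfolding lin_def by (rule kernel_subst_linear)
  have "kernel_subst 1 (lin \<delta> * N) z = (z - fps_const \<delta>) * kernel_subst 0 N z"
    using kernel_subst_mult[OF lin N, of \<delta> z] by (simp only: add_0_right lin_subst)
  then have "kernel_subst 1 ?H z =
      z - fps_const (1 + \<delta>) - (z - fps_const \<delta>) * kernel_subst 0 N z"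
    by (simp only: kernel_subst_diff lin_subst)
  also have "\<dots> = 0" by (subst z(1)) simp
  finally have H0: "kernel_subst 1 ?H z = 0" .
  have H: "xbounded 1 ?H"
    using lin N xbounded_mult[OF lin N] by (simp add: xbounded_diff)
  \<comment> \<open>Multiplying \<open>ker\<close> by q and replacing q A by p removes the series
    A.\<close>
  have "fps2_of_poly q * lin \<delta> = fps2_of_poly p * ?H"
    by (subst ker[symmetric], subst q(2)[symmetric]) (simp only: mult.assoc)
  then have "kernel_subst (d + 1) (fps2_of_poly q * lin \<delta>) z =
      kernel_subst (d + 1) (fps2_of_poly p * ?H) z" by simp
  \<comment> \<open>The right side is killed by \<open>H0\<close>; the factor z - \<delta> on the
    left can then be cancelled by \<open>z(2)\<close>.\<close>
  then have "kernel_subst d (fps2_of_poly q) z * (z - fps_const \<delta>) = 0"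
    by (simp add: kernel_subst_mult xbounded_fps2_of_poly lin H d_def H0 lin_subst
        del: One_nat_def add_Suc_right Suc_eq_plus1)
  then have "kernel_subst d (fps2_of_poly q) z = 0" using z(2) by simp
  then show ?thesis
    using algebraic_fps_of_kernel_subst[of q d z] q(1) by (simp add: d_def)
qed

section \<open>The recurrence for descents\<close>

text \<open>The operator that prepends one non-horizontal step, the variable marking the gain in \<open>y\<close>.\<close>

definition up_step :: "(nat \<Rightarrow> nat \<Rightarrow> 'a::comm_ring_1) \<Rightarrow> (nat \<Rightarrow> 'a fps) \<Rightarrow> nat \<Rightarrow> 'a fps" where
  "up_step s F k = diag (Abs_fps (\<lambda>b. \<Sum>a\<le>b. fps_const (s a b) * F (k + b - a)))"

lemma up_step_mult_left: "up_step s (\<lambda>k. c * F k) k = c * up_step s F k"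
proof -
  have "c * up_step s F k =
      diag (fps_const c * Abs_fps (\<lambda>b. \<Sum>a\<le>b. fps_const (s a b) * F (k + b - a)))"
    by (simp add: up_step_def diag_mult diag_const)
  also have "\<dots> = up_step s (\<lambda>k. c * F k) k"
    unfolding up_step_def
    by (rule arg_cong[where f = diag], rule fps_ext) (simp add: sum_distrib_left mult_ac)
  finally show ?thesis by simp
qed

lemma up_step_diff: "up_step s (\<lambda>k. F k - G k) k = up_step s F k - up_step s G k"
  unfolding up_step_def diag_diff[symmetric]
  by (rule arg_cong[where f = diag], rule fps_ext) (simp add: sum_subtractf right_diff_distrib)

lemma up_step_shift: "up_step s (\<lambda>j. F (j + m)) k = up_step s F (k + m)"
  unfolding up_step_def
  by (rule arg_cong[where f = diag], rule fps_ext) (auto intro!: sum.cong simp: algebra_simps)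

lemma up_step_nth:
  "up_step s F k $ n = (\<Sum>b\<le>n. \<Sum>a\<le>b. s a b * F (k + b - a) $ (n - b))"
  by (simp add: up_step_def diag_nth fps_sum_nth)

text \<open>As \<open>s a 0 = 0\<close>, the coefficient of t^n in \<open>up_step s L\<close>
  involves only coefficients of \<open>L\<close> below n. Induction on n thus reduces the recurrence
  at t^n to \<open>L (Suc j) = c * L j\<close>, which is settled by induction on j.\<close>

lemma up_step_recurrence_unique:
  assumes s: "\<And>a. s a 0 = 0" and "L 0 = 0"
    and rec: "\<And>j. L (Suc j) = fps_const c * L j + up_step s L (Suc j) - fps_const d * up_step s L j"
  shows "L j = 0"
proof -
  have "L j $ n = 0" for n j
  proof (induction n arbitrary: j rule: less_induct)
    case (less n)
    have up: "up_step s L k $ n = 0" for k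
      unfolding up_step_nth
    proof (intro sum.neutral ballI)
      fix b a assume "b \<in> {..n}"
      then show "s a b * L (k + b - a) $ (n - b) = 0"
        using s less[of "n - b"] by (cases "b = 0") auto
    qed
    show ?case
    proof (induction j)
      case (Suc j)
      then show ?case by (subst rec) (simp add: up)
    qed (simp add: assms(2))
  qed
  then show ?thesis by (intro fps_ext) simp
qed

text \<open>The recurrence makes \<open>G\<close> geometric from height 1 on and gives the equation
  for z. Height 0 lies outside the geometric range, and in \<open>up_step s G 0\<close> it occurs
  only for diagonal steps; this is how \<open>D\<close> enters.\<close>

lemma descent_series_kernel:
  fixes s :: "nat \<Rightarrow> nat \<Rightarrow> 'a::field" and G :: "nat \<Rightarrow> 'a fps"
  defines "N \<equiv> Abs_fps (\<lambda>a. Abs_fps (\<lambda>b. s a b))" and "D \<equiv> Abs_fps (\<lambda>b. s b b)"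
  assumes s: "\<And>a. s a 0 = 0"
    and G0: "G 0 = 1 + up_step s G 0"
    and G1: "G 1 = G 0 + up_step s G 1"
    and rec: "\<And>k. G (Suc (Suc k)) = fps_const (1 + \<delta>) * G (Suc k) + up_step s G (Suc (Suc k))
      - fps_const \<delta> * up_step s G (Suc k)"
    and nz: "G 1 $ 0 \<noteq> 0"
  obtains z where "z = fps_const (1 + \<delta>) + (z - fps_const \<delta>) * kernel_subst 0 N z"
    "z \<noteq> fps_const \<delta>" "G 0 * (fps_const (1 + \<delta>) - fps_const \<delta> * D) = z"
proof -
  define z where "z = G 2 * inverse (G 1)"
  have inv: "G 1 * inverse (G 1) = 1"
    using nz by (simp add: inverse_mult_eq_1')
  have geo: "G (Suc (Suc j)) = z * G (Suc j)" for j
  proof -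
    \<comment> \<open>On indices \<open>\<ge> 1\<close> the sequences \<open>j \<mapsto> G\<^sub>2 G\<^sub>j\<close> and \<open>j \<mapsto> G\<^sub>1 G\<^sub>j\<^sub>+\<^sub>1\<close> satisfy the same recurrence and
      agree at \<open>j = 1\<close>.\<close>
    let ?L = "\<lambda>j. G 2 * G (j + 1) - G 1 * G (j + 2)"
    have up: "up_step s ?L k = G 2 * up_step s G (k + 1) - G 1 * up_step s G (k + 2)" for k
      by (simp only: up_step_diff up_step_mult_left up_step_shift)
    have "?L j = 0"
    proof (rule up_step_recurrence_unique[where s = s and L = ?L and c = "1 + \<delta>" and d = \<delta>])
      show "?L (Suc j) = fps_const (1 + \<delta>) * ?L j + up_step s ?L (Suc j) - fps_const \<delta> * up_step s ?L j" for j
      proof -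
        have "?L (Suc j) = G 2 * (fps_const (1 + \<delta>) * G (Suc j) + up_step s G (Suc (Suc j))
            - fps_const \<delta> * up_step s G (Suc j)) - G 1 * (fps_const (1 + \<delta>) * G (Suc (Suc j))
            + up_step s G (Suc (Suc (Suc j))) - fps_const \<delta> * up_step s G (Suc (Suc j)))"
          using rec[of j] rec[of "Suc j"] by simp
        then show ?thesis unfolding up by (simp add: algebra_simps)
      qed
    qed (simp_all add: numeral_2_eq_2 s)
    then have "G 1 * inverse (G 1) * G (j + 2) = z * G (j + 1)"
      by (simp add: z_def mult_ac del: One_nat_def)
    then show ?thesis by (simp only: inv) simp
  qed
  have pow: "G (Suc j) = G 1 * z ^ j" for j
    by (induction j) (simp_all add: geo mult_ac)
  define M where "M = kernel_subst 0 N z"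
  have M: "M = diag (Abs_fps (\<lambda>b. \<Sum>a\<le>b. fps_const (s a b) * z ^ (b - a)))"
    by (simp add: M_def kernel_subst_def N_def)
  \<comment> \<open>As a \<le> b, all heights occurring here are at least 1, where \<open>G\<close>
    is geometric.\<close>
  have up_Suc: "up_step s G (Suc k) = G 1 * z ^ k * M" for k
  proof -
    have "up_step s G (Suc k) = diag (Abs_fps (\<lambda>b. \<Sum>a\<le>b. fps_const (s a b) * (G 1 * z ^ k * z ^ (b - a))))"
      unfolding up_step_def
    proof (rule arg_cong[where f = diag], rule arg_cong[where f = Abs_fps], rule ext,
        rule sum.cong[OF refl])
      fix b a :: nat assume "a \<in> {..b}"
      then have "Suc k + b - a = Suc (k + (b - a))" by simp
      then show "fps_const (s a b) * G (Suc k + b - a) = fps_const (s a b) * (G 1 * z ^ k * z ^ (b - a))"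
        using pow[of "k + (b - a)"] by (simp only: power_add mult.assoc)
    qed
    also have "\<dots> = up_step s (\<lambda>j. G 1 * z ^ k * z ^ j) 0"
      by (simp add: up_step_def)
    also have "\<dots> = G 1 * z ^ k * M"
      unfolding up_step_mult_left by (simp add: up_step_def M)
    finally show ?thesis .
  qed
  \<comment> \<open>For j \<ge> 1, \<open>z * G j\<close> equals \<open>G 1 * z ^ j\<close>; at j =
    0 there is the defect \<open>z * G 0 - G 1\<close>, met only for a = b.\<close>
  have up_0: "z * up_step s G 0 = D * (z * G 0 - G 1) + G 1 * M"
  proof -
    have "z * up_step s G 0 = up_step s (\<lambda>j. z * G j) 0"
      by (simp add: up_step_mult_left)
    also have "\<dots> = diag (Abs_fps (\<lambda>b. fps_const (s b b)) * fps_const (z * G 0 - G 1)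
        + fps_const (G 1) * Abs_fps (\<lambda>b. \<Sum>a\<le>b. fps_const (s a b) * z ^ (b - a)))"
      unfolding up_step_def
    proof (rule arg_cong[where f = diag], rule fps_ext)
      fix b
      have "(\<Sum>a\<le>b. fps_const (s a b) * (z * G (0 + b - a))) =
          (\<Sum>a\<le>b. (if a = b then fps_const (s b b) * (z * G 0 - G 1) else 0) +
            G 1 * (fps_const (s a b) * z ^ (b - a)))"
      proof (rule sum.cong[OF refl])
        fix a assume "a \<in> {..b}"
        then consider "a = b" | j where "b - a = Suc j" by (cases "b - a") auto
        then show "fps_const (s a b) * (z * G (0 + b - a)) =
          (if a = b then fps_const (s b b) * (z * G 0 - G 1) else 0) +
            G 1 * (fps_const (s a b) * z ^ (b - a))"
        proof cases
          case 1
          then show ?thesis by (simp add: algebra_simps)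
        next
          case 2
          then show ?thesis using pow[of j] by (auto simp: mult_ac)
        qed
      qed
      then show "Abs_fps (\<lambda>b. \<Sum>a\<le>b. fps_const (s a b) * (z * G (0 + b - a))) $ b =
         (Abs_fps (\<lambda>b. fps_const (s b b)) * fps_const (z * G 0 - G 1)
        + fps_const (G 1) * Abs_fps (\<lambda>b. \<Sum>a\<le>b. fps_const (s a b) * z ^ (b - a))) $ b"
        by (simp add: sum.distrib sum_distrib_left)
    qed
    also have "diag (Abs_fps (\<lambda>b. fps_const (s b b))) = D"
    proof (rule fps_ext)
      fix n
      have "diag (Abs_fps (\<lambda>b. fps_const (s b b))) $ n = (\<Sum>b\<le>n. if b = n then s n n else 0)"
        unfolding diag_nth by (intro sum.cong) auto
      then show "diag (Abs_fps (\<lambda>b. fps_const (s b b))) $ n = D $ n" by (simp add: D_def)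
    qed
    then have "diag (Abs_fps (\<lambda>b. fps_const (s b b)) * fps_const (z * G 0 - G 1)
        + fps_const (G 1) * Abs_fps (\<lambda>b. \<Sum>a\<le>b. fps_const (s a b) * z ^ (b - a))) =
        D * (z * G 0 - G 1) + G 1 * M"
      by (simp add: diag_add diag_mult diag_const M)
    finally show ?thesis .
  qed
  let ?d = "fps_const \<delta>"
  have e1: "G 1 * (1 - M) = G 0"
    using G1 up_Suc[of 0] by (simp add: algebra_simps)
  have "G 1 * z = G 1 * (fps_const (1 + \<delta>) + (z - ?d) * M)"
    using rec[of 0] up_Suc[of 0] up_Suc[of 1] pow[of 1] by (simp add: algebra_simps)
  then have e2: "z = fps_const (1 + \<delta>) + (z - ?d) * M"
    using nz by (metis mult_left_cancel fps_zero_nth)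
  have c: "fps_const (1 + \<delta>) = 1 + ?d"
    by (simp flip: fps_const_add)
  \<comment> \<open>By \<open>e2\<close>, z - \<delta> is the inverse of 1 - M.\<close>
  have e3: "G 1 = (z - ?d) * G 0"
  proof -
    have "(z - ?d) * (1 - M) = 1" using e2 unfolding c by (simp add: algebra_simps)
    then show ?thesis using e1 by (metis mult.commute mult.left_commute mult_1)
  qed
  have "z * G 0 = z + D * (z * G 0 - G 1) + (G 1 - G 0)"
  proof -
    have "z * G 0 = z + z * up_step s G 0" by (subst G0) (simp add: algebra_simps)
    also have "G 1 * M = G 1 - G 0" using e1 by (simp add: algebra_simps)
    then have "z * up_step s G 0 = D * (z * G 0 - G 1) + (G 1 - G 0)" using up_0 by simp
    finally show ?thesis by (simp add: add.assoc)
  qed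
  \<comment> \<open>After \<open>e3\<close> the terms with \<open>z * G 0\<close> cancel, and the
    rest is linear in \<open>G 0\<close>.\<close>
  then have "G 0 * (fps_const (1 + \<delta>) - ?d * D) = z"
    unfolding e3 c by (simp add: algebra_simps)
  moreover have "z \<noteq> ?d"
  proof
    assume "z = ?d"
    with e2 c show False by simp
  qed
  ultimately show thesis using that e2 unfolding M_def by blast
qed

section \<open>Decomposition of paths by their first step\<close>

lemma nodes_Cons: "nodes (z # w) = insert 0 ((+) z ` nodes w)"
proof (intro equalityI subsetI)
  fix u assume "u \<in> nodes (z # w)"
  then obtain k where k: "k \<le> length (z # w)" "u = sum_list (take k (z # w))"
    by (auto simp: nodes_def)
  then show "u \<in> insert 0 ((+) z ` nodes w)"
    by (cases k) (auto simp: nodes_def)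
next
  fix u assume "u \<in> insert 0 ((+) z ` nodes w)"
  then consider "u = 0" | k where "k \<le> length w" "u = z + sum_list (take k w)"
    by (auto simp: nodes_def)
  then show "u \<in> nodes (z # w)"
  proof cases
    case 1
    then show ?thesis by (auto simp: nodes_def intro!: exI[of _ 0])
  next
    case 2
    then show ?thesis by (auto simp: nodes_def intro!: exI[of _ "Suc k"])
  qed
qed

lemma nodes_Nil: "nodes [] = {0}"
  by (auto simp: nodes_def)

lemma zero_in_nodes: "0 \<in> nodes w"
  by (auto simp: nodes_def intro!: exI[of _ 0])

lemma Cons_in_UN_Cons_iff: "z # v \<in> (\<Union>z\<in>B. (#) z ` V z) \<longleftrightarrow> z \<in> B \<and> v \<in> V z"
  by auto

text \<open>Different heads give disjoint sets, and prepending a fixed head is injective;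
  \<open>E\<close> is the possible contribution of the empty path.\<close>

lemma card_lists_by_head:
  assumes W: "W = E \<union> (\<Union>z\<in>B. (#) z ` V z)"
    and "finite B" "\<And>z. z \<in> B \<Longrightarrow> finite (V z)" "E \<subseteq> {[]}"
  shows "card W = card E + (\<Sum>z\<in>B. card (V z))"
proof -
  have "card (\<Union>z\<in>B. (#) z ` V z) = (\<Sum>z\<in>B. card ((#) z ` V z))"
    using assms(2,3) by (intro card_UN_disjoint) auto
  also have "\<dots> = (\<Sum>z\<in>B. card (V z))"
    by (intro sum.cong refl card_image) auto
  finally have "card (\<Union>z\<in>B. (#) z ` V z) = (\<Sum>z\<in>B. card (V z))" .
  moreover have "card W = card E + card (\<Union>z\<in>B. (#) z ` V z)"
    unfolding W using assms(2-4) by (intro card_Un_disjoint) (auto intro: finite_subset)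
  ultimately show ?thesis by simp
qed

lemma Nil_in_paths_iff: "[] \<in> paths S (n, m) \<longleftrightarrow> n = 0 \<and> m = 0"
  by (auto simp: paths_def zero_prod_def)

lemma Cons_in_paths_iff:
  "(a, b) # w \<in> paths S (n, m) \<longleftrightarrow>
     (a, b) \<in> S \<and> a \<le> n \<and> b \<le> m \<and> w \<in> paths S (n - a, m - b)"
  by (cases "sum_list w") (auto simp: paths_def)

lemma card_paths_rec:
  assumes "(0, 0) \<notin> S"
  shows "card (paths S (n, m)) = (if n = 0 \<and> m = 0 then 1 else 0) +
    (\<Sum>a\<le>n. \<Sum>b\<le>m. if (a, b) \<in> S then card (paths S (n - a, m - b)) else 0)"
proof -
  let ?B = "({..n} \<times> {..m}) \<inter> S"
  let ?E = "if n = 0 \<and> m = 0 then {[]} else {}"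
  have E: "card ?E = (if n = 0 \<and> m = 0 then 1 else 0)" by simp
  have eq: "paths S (n, m) = ?E \<union> (\<Union>z\<in>?B. (#) z ` paths S (n - fst z, m - snd z))"
  proof (rule Set.set_eqI)
    fix w
    show "w \<in> paths S (n, m) \<longleftrightarrow>
        w \<in> ?E \<union> (\<Union>z\<in>?B. (#) z ` paths S (n - fst z, m - snd z))"
      proof (cases w)
      case Nil
      then show ?thesis by (auto simp: Nil_in_paths_iff)
    next
      case (Cons z v)
      have "w \<in> (\<Union>z\<in>?B. (#) z ` paths S (n - fst z, m - snd z)) \<longleftrightarrow>
          z \<in> ?B \<and> v \<in> paths S (n - fst z, m - snd z)"
        unfolding Cons by (rule Cons_in_UN_Cons_iff)
      then show ?thesis unfolding Un_iff
        using Cons by (cases z) (auto simp: Cons_in_paths_iff simp del: UN_iff)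
    qed
  qed
  have "card (paths S (n, m)) = card ?E + (\<Sum>z\<in>?B. card (paths S (n - fst z, m - snd z)))"
    using card_lists_by_head[of "paths S (n, m)" ?E "\<lambda>z. paths S (n - fst z, m - snd z)" ?B, OF eq] assms
    by (auto simp: finite_paths split: if_splits)
  also have "(\<Sum>z\<in>?B. card (paths S (n - fst z, m - snd z))) =
      (\<Sum>z\<in>{..n} \<times> {..m}. if z \<in> S then card (paths S (n - fst z, m - snd z)) else 0)"
    by (rule sum.inter_restrict) simp
  also have "\<dots> = (\<Sum>a\<le>n. \<Sum>b\<le>m. if (a, b) \<in> S then card (paths S (n - a, m - b)) else 0)"
    by (simp add: sum.cartesian_product case_prod_unfold)
  finally show ?thesis unfolding E .
qed

text \<open>Paths from height \<open>k\<close> to height \<open>0\<close>, where the height of \<open>(x, y)\<close> is \<open>y - x\<close>; they are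
  translated so as to start at the origin.\<close>

definition descents :: "step set \<Rightarrow> nat \<Rightarrow> nat \<Rightarrow> step list set" where
  "descents S k m = {w \<in> paths S (m + k, m). \<forall>(x, y) \<in> nodes w. x \<le> y + k}"

lemma catalan_paths_eq_descents: "catalan_paths S (n, n) = descents S 0 n"
  by (auto simp: catalan_paths_def descents_def has_right_boundary_def catalan_boundary_def
      less_Suc_eq_le)

lemma finite_descents: "(0, 0) \<notin> S \<Longrightarrow> finite (descents S k m)"
  by (simp add: descents_def finite_paths)

text \<open>The condition a \<le> k + b is the bound at the node after the first step, and it makes
  the new height k + b - a an exact subtraction.\<close>

lemma Cons_in_descents_iff:
  "(a, b) # w \<in> descents S k m \<longleftrightarrow>
     (a, b) \<in> S \<and> b \<le> m \<and> a \<le> k + b \<and> w \<in> descents S (k + b - a) (m - b)"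
proof -
  obtain x y where xy: "sum_list w = (x, y)" by force
  have nodes: "(\<forall>(x, y) \<in> nodes ((a, b) # w). x \<le> y + k) \<longleftrightarrow>
      a \<le> k + b \<and> (\<forall>(x, y) \<in> nodes w. x \<le> y + (k + b - a))" (is "?L \<longleftrightarrow> ?R")
  proof
    assume L: ?L
    then have *: "a + x \<le> b + y + k" if "(x, y) \<in> nodes w" for x y
      using that by (force simp: nodes_Cons)
    from *[of 0 0] have "a \<le> k + b" using zero_in_nodes[of w] by (simp add: zero_prod_def)
    with * show ?R by fastforce
  next
    assume ?R
    then show ?L by (fastforce simp: nodes_Cons zero_prod_def)
  qed
  show ?thesis unfolding descents_def mem_Collect_eq nodes
    using xy by (auto simp: paths_def)
qed

lemma Nil_in_descents_iff: "[] \<in> descents S k m \<longleftrightarrow> k = 0 \<and> m = 0"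
  by (auto simp: descents_def paths_def nodes_Nil zero_prod_def)

lemma card_descents_rec:
  assumes "(0, 0) \<notin> S"
  shows "card (descents S k m) = (if k = 0 \<and> m = 0 then 1 else 0) +
    (\<Sum>b\<le>m. \<Sum>a\<le>k + b. if (a, b) \<in> S then card (descents S (k + b - a) (m - b)) else 0)"
proof -
  \<comment> \<open>Pairs are swapped because the range of a depends on b, as \<open>Sigma\<close>
    needs; \<open>?B'\<close> restores the order of a step.\<close>
  let ?B = "{(b, a). b \<le> m \<and> a \<le> k + b \<and> (a, b) \<in> S}"
  let ?B' = "(\<lambda>(b, a). (a, b)) ` ?B"
  let ?E = "if k = 0 \<and> m = 0 then {[]} else {}"
  let ?V = "\<lambda>(a, b). descents S (k + b - a) (m - b)"
  have B: "?B = Sigma {..m} (\<lambda>b. {..k + b}) \<inter> {(b, a). (a, b) \<in> S}" by auto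
  have E: "card ?E = (if k = 0 \<and> m = 0 then 1 else 0)" by simp
  have eq: "descents S k m = ?E \<union> (\<Union>z\<in>?B'. (#) z ` ?V z)"
  proof (rule Set.set_eqI)
    fix w
    show "w \<in> descents S k m \<longleftrightarrow> w \<in> ?E \<union> (\<Union>z\<in>?B'. (#) z ` ?V z)"
      proof (cases w)
      case Nil
      then show ?thesis by (auto simp: Nil_in_descents_iff)
    next
      case (Cons z v)
      obtain a b where z: "z = (a, b)" by force
      have U: "w \<in> (\<Union>z\<in>?B'. (#) z ` ?V z) \<longleftrightarrow> z \<in> ?B' \<and> v \<in> ?V z"
        unfolding Cons by (rule Cons_in_UN_Cons_iff)
      have B': "z \<in> ?B' \<longleftrightarrow> b \<le> m \<and> a \<le> k + b \<and> (a, b) \<in> S" unfolding z by force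
      have E: "w \<notin> ?E" using Cons by simp
      have "w \<in> descents S k m \<longleftrightarrow> z \<in> ?B' \<and> v \<in> ?V z"
        unfolding B' unfolding Cons z Cons_in_descents_iff prod.case by (simp only: conj_ac)
      then show ?thesis using E by (simp only: Un_iff U simp_thms)
    qed
  qed
  have "card (descents S k m) = card ?E + (\<Sum>z\<in>?B'. card (?V z))"
    using card_lists_by_head[of "descents S k m" ?E ?V ?B', OF eq] assms
    by (auto simp: B finite_descents split: if_splits)
  also have "(\<Sum>z\<in>?B'. card (?V z)) = (\<Sum>z\<in>?B. card (?V ((\<lambda>(b, a). (a, b)) z)))"
    by (rule sum.reindex_cong[OF _ refl refl]) (auto simp: inj_on_def)
  also have "\<dots> = (\<Sum>z\<in>Sigma {..m} (\<lambda>b. {..k + b}). if z \<in> {(b, a). (a, b) \<in> S} then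
      card (?V ((\<lambda>(b, a). (a, b)) z)) else 0)"
    unfolding B by (rule sum.inter_restrict) simp
  also have "\<dots> = (\<Sum>b\<le>m. \<Sum>a\<le>k + b. if (a, b) \<in> S then card (descents S (k + b - a) (m - b)) else 0)"
    by (subst sum.Sigma) (auto intro!: sum.cong)
  finally show ?thesis unfolding E .
qed

section \<open>Generating functions of descents and of all paths\<close>

lemma slope_condition_catalan_boundary:
  assumes "slope_condition S catalan_boundary" "(a, b) \<in> S" "b \<noteq> 0"
  shows "a \<le> b"
proof -
  \<comment> \<open>The instance i = 0, j = b, where j a/b collapses to a.\<close>
  have "rat_of_nat (catalan_boundary (0 + b)) > rat_of_nat (catalan_boundary 0) - 1 +
      rat_of_nat b * rat_of_nat a / rat_of_nat b"
    using assms unfolding slope_condition_def by fastforce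
  then have "rat_of_nat a < rat_of_nat (b + 1)" using assms(3) by (simp add: catalan_boundary_def)
  then show ?thesis unfolding of_nat_less_iff by simp
qed

text \<open>The coefficients of the series N of non-horizontal steps, in the form that
  \<open>up_step\<close> takes.\<close>

definition up_indicator :: "step set \<Rightarrow> nat \<Rightarrow> nat \<Rightarrow> rat" where
  "up_indicator S a b = (if b \<noteq> 0 \<and> (a, b) \<in> S then 1 else 0)"

definition descent_series :: "step set \<Rightarrow> nat \<Rightarrow> rat fps" where
  "descent_series S k = Abs_fps (\<lambda>m. of_nat (card (descents S k m)))"

text \<open>The terms b = 0 of the first-step decomposition are the horizontal steps. For b > 0 the
  bound a \<le> b cuts the range a \<le> k + b down to the one in \<open>up_step\<close>.\<close>

lemma descent_series_rec:
  assumes S0: "(0, 0) \<notin> S" and up: "\<And>a b. (a, b) \<in> S \<Longrightarrow> b \<noteq> 0 \<Longrightarrow> a \<le> b"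
  shows "descent_series S k = (if k = 0 then 1 else 0) +
    (\<Sum>a\<le>k. if (a, 0) \<in> S then descent_series S (k - a) else 0) +
    up_step (up_indicator S) (descent_series S) k"
proof (rule fps_ext)
  fix m
  let ?g = "\<lambda>k m. rat_of_nat (card (descents S k m))"
  let ?t = "\<lambda>b. \<Sum>a\<le>k + b. if (a, b) \<in> S then ?g (k + b - a) (m - b) else 0"
  have "?g k m = (if k = 0 \<and> m = 0 then 1 else 0) + (\<Sum>b\<le>m. ?t b)"
    by (subst card_descents_rec[OF S0]) (simp add: if_distrib[where f = rat_of_nat] cong: if_cong)
  also have "(\<Sum>b\<le>m. ?t b) = ?t 0 + (\<Sum>b\<in>{..m} - {0}. ?t b)"
    by (subst sum.remove[of _ 0]) auto
  also have "(\<Sum>b\<in>{..m} - {0}. ?t b) =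
      (\<Sum>b\<in>{..m} - {0}. \<Sum>a\<le>b. up_indicator S a b * descent_series S (k + b - a) $ (m - b))"
  proof (rule sum.cong[OF refl])
    fix b assume b: "b \<in> {..m} - {0}"
    show "?t b = (\<Sum>a\<le>b. up_indicator S a b * descent_series S (k + b - a) $ (m - b))"
      using b up by (intro sum.mono_neutral_cong_right)
        (auto simp: up_indicator_def descent_series_def)
  qed
  also have "\<dots> = up_step (up_indicator S) (descent_series S) k $ m"
    unfolding up_step_nth
    by (intro sum.mono_neutral_left) (auto simp: up_indicator_def)
  finally show "descent_series S k $ m = ((if k = 0 then 1 else 0) +
    (\<Sum>a\<le>k. if (a, 0) \<in> S then descent_series S (k - a) else 0) +
    up_step (up_indicator S) (descent_series S) k) $ m"
    by (simp add: descent_series_def fps_sum_nth if_distrib[where f = "\<lambda>f. fps_nth f m"]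
        cong: if_cong)
qed

definition step_series :: "step set \<Rightarrow> rat fps fps" where
  "step_series S = Abs_fps (\<lambda>a. Abs_fps (\<lambda>b. if (a, b) \<in> S then 1 else 0))"

text \<open>The first step of a nonempty path contributes \<open>step_series S\<close>; rearranged,
  \<open>A_series S\<close> is the inverse of \<open>1 - step_series S\<close>.\<close>

lemma A_series_rec:
  assumes "(0, 0) \<notin> S"
  shows "A_series S = 1 + step_series S * A_series S"
proof (intro fps_ext)
  fix n m
  let ?a = "\<lambda>n m. rat_of_nat (card (paths S (n, m)))"
  have "?a n m = (if n = 0 \<and> m = 0 then 1 else 0) +
      (\<Sum>a\<le>n. \<Sum>b\<le>m. if (a, b) \<in> S then ?a (n - a) (m - b) else 0)"
    by (subst card_paths_rec[OF assms]) (simp add: if_distrib[where f = rat_of_nat] cong: if_cong)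
  also have "(\<Sum>a\<le>n. \<Sum>b\<le>m. if (a, b) \<in> S then ?a (n - a) (m - b) else 0) =
      (step_series S * A_series S) $ n $ m"
    by (simp add: step_series_def A_series_def fps_mult_nth fps_sum_nth atLeast0AtMost)
      (intro sum.cong; simp)
  finally show "A_series S $ n $ m = (1 + step_series S * A_series S) $ n $ m"
    by (simp add: A_series_def fps_one_nth)
qed

theorem theorem4p1:
  fixes S :: "(nat \<times> nat) set"
  assumes "(0, 0) \<notin> S"
    and "slope_condition S catalan_boundary"
    and "(\<forall>a>0. (a, 0) \<in> S) \<or> (\<forall>a. (a, 0) \<in> S \<longleftrightarrow> a = 1)"
    and "rational_fps2 (A_series S)"
    and "algebraic_fps (T_series S)"
  shows "algebraic_fps (P_series S)"
proof -
  let ?s = "up_indicator S" and ?G = "descent_series S"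
  define \<delta> :: rat where "\<delta> = (if \<forall>a>0. (a, 0) \<in> S then 1 else 0)"
  define N where "N = Abs_fps (\<lambda>a. Abs_fps (\<lambda>b. ?s a b))"
  have horizontal: "(a, 0) \<in> S \<longleftrightarrow> a = 1 \<or> a > 1 \<and> \<delta> = 1" for a
    using assms(1,3) by (cases "a = 0"; cases "a = 1") (auto simp: \<delta>_def)
  have \<delta>: "\<delta> = 0 \<or> \<delta> = 1" by (simp add: \<delta>_def)
  have up: "a \<le> b" if "(a, b) \<in> S" "b \<noteq> 0" for a b
    using slope_condition_catalan_boundary[OF assms(2)] that by blast
  have rec: "?G k = (if k = 0 then 1 else 0) +
      (\<Sum>a\<le>k. if (a, 0) \<in> S then ?G (k - a) else 0) + up_step ?s ?G k" for k
    using assms(1) up by (rule descent_series_rec)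
  \<comment> \<open>The step (1, 0) is always present and gives \<open>?G k\<close>. For a > 0, (a +
    1, 0) is a step exactly if \<delta> = 1, and then (a, 0) is one too.\<close>
  have drop: "(\<Sum>a\<le>Suc k. if (a, 0) \<in> S then ?G (Suc k - a) else 0) =
      ?G k + fps_const \<delta> * (\<Sum>a\<le>k. if (a, 0) \<in> S then ?G (k - a) else 0)" for k
  proof -
    have "(\<Sum>a\<le>Suc k. if (a, 0) \<in> S then ?G (Suc k - a) else 0) =
        (\<Sum>a\<le>k. if (Suc a, 0) \<in> S then ?G (k - a) else 0)"
      using assms(1) by (subst sum.atMost_Suc_shift) (simp cong: if_cong)
    also have "\<dots> = (\<Sum>a\<le>k. (if a = 0 then ?G k else 0) +
        fps_const \<delta> * (if (a, 0) \<in> S then ?G (k - a) else 0))"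
      using \<delta> by (intro sum.cong) (auto simp: horizontal)
    finally show ?thesis by (simp add: sum.distrib sum_distrib_left)
  qed
  have G0: "?G 0 = 1 + up_step ?s ?G 0"
    by (subst rec) (use assms(1) in simp_all)
  have G_Suc: "?G (Suc k) = ?G k + fps_const \<delta> * (\<Sum>a\<le>k. if (a, 0) \<in> S then ?G (k - a) else 0) +
      up_step ?s ?G (Suc k)" for k
    using rec[of "Suc k"] unfolding drop by simp
  have G1: "?G 1 = ?G 0 + up_step ?s ?G 1"
    using G_Suc[of 0] assms(1) by simp
  have G2: "?G (Suc (Suc k)) = fps_const (1 + \<delta>) * ?G (Suc k) + up_step ?s ?G (Suc (Suc k)) -
      fps_const \<delta> * up_step ?s ?G (Suc k)" for k
  proof -
    \<comment> \<open>The horizontal sum is eliminated by means of the equation at height k +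
      1.\<close>
    let ?h = "\<Sum>a\<le>Suc k. if (a, 0) \<in> S then ?G (Suc k - a) else 0"
    have "?G (Suc k) = ?h + up_step ?s ?G (Suc k)"
      using rec[of "Suc k"] by simp
    then have h: "?h = ?G (Suc k) - up_step ?s ?G (Suc k)" by simp
    show ?thesis unfolding G_Suc[of "Suc k"] h
      by (simp add: algebra_simps flip: fps_const_add)
  qed
  have up0: "up_step ?s F k $ 0 = 0" for F k
    by (simp add: up_step_nth up_indicator_def)
  \<comment> \<open>Without gain in y, the only path from height 1 to height 0 is the single step
    (1, 0).\<close>
  have "?G 1 $ 0 = 1"
    by (subst G1, subst G0) (simp add: up0)
  then have nz: "?G 1 $ 0 \<noteq> 0" by simp
  have s0: "?s a 0 = 0" for a by (simp add: up_indicator_def)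
  have T: "Abs_fps (\<lambda>b. ?s b b) = T_series S"
    using assms(1) by (intro fps_ext) (auto simp: up_indicator_def T_series_def)
  obtain z where z: "z = fps_const (1 + \<delta>) + (z - fps_const \<delta>) * kernel_subst 0 N z"
    "z \<noteq> fps_const \<delta>" "?G 0 * (fps_const (1 + \<delta>) - fps_const \<delta> * T_series S) = z"
    using descent_series_kernel[of ?s ?G \<delta>, OF s0 G0 G1 G2 nz] unfolding T N_def[symmetric]
    by blast
  have "algebraic_fps z"
  proof (rule algebraic_fps_of_kernel[OF assms(4) _ _ z(1,2)])
    show "xbounded 0 N"
      unfolding xbounded_def
    proof (intro allI impI)
      fix a b :: nat assume "a > b + 0"
      then show "N $ a $ b = 0" using up[of a b] by (auto simp: N_def up_indicator_def)
    qed
    let ?lin = "\<lambda>c. 1 - fps_const (fps_const c) * fps_X :: rat fps fps"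
    \<comment> \<open>The horizontal steps have the generating function x/(1 - \<delta>x), that is,
      x or x/(1 - x).\<close>
    have h: "?lin \<delta> * (step_series S - N) = fps_X"
    proof -
      have nth: "(step_series S - N) $ a = (if a = 1 \<or> a > 1 \<and> \<delta> = 1 then 1 else 0)" for a
        by (rule fps_ext) (auto simp: step_series_def N_def up_indicator_def horizontal)
      show ?thesis
      proof (rule fps_ext)
        fix a
        have "(?lin \<delta> * (step_series S - N)) $ a = (step_series S - N) $ a -
            fps_const \<delta> * (if a = 0 then 0 else (step_series S - N) $ (a - 1))"
          by (simp add: left_diff_distrib mult.assoc)
        also have "\<dots> = fps_X $ a" unfolding nth using \<delta> by (auto simp: fps_X_def)
        finally show "(?lin \<delta> * (step_series S - N)) $ a = fps_X $ a" .
      qed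
    qed
    have lin: "?lin (1 + \<delta>) = ?lin \<delta> - fps_X"
      by (simp add: algebra_simps flip: fps_const_add)
    \<comment> \<open>This is the kernel in factored form, so its product with A is 1 -
      \<delta>x.\<close>
    have "?lin (1 + \<delta>) - ?lin \<delta> * N = ?lin \<delta> * (1 - step_series S)"
      unfolding lin by (subst (2) h[symmetric]) (simp add: algebra_simps)
    moreover have "A_series S * (1 - step_series S) = 1"
      using A_series_rec[OF assms(1)] by (simp add: algebra_simps)
    ultimately show "A_series S * (?lin (1 + \<delta>) - ?lin \<delta> * N) = ?lin \<delta>"
      by (metis mult.commute mult.left_commute mult_1_right)
  qed
  moreover
  let ?D = "fps_const (1 + \<delta>) - fps_const \<delta> * T_series S"
  \<comment> \<open>T has no constant term as (0, 0) is not a step, so the constant term here is 1 +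
    \<delta>, which is 1 or 2.\<close>
  have D0: "?D $ 0 \<noteq> 0" using assms(1) \<delta> by (auto simp: T_series_def)
  have "algebraic_fps (inverse ?D)"
    by (intro algebraic_fps_inverse algebraic_fps_diff algebraic_fps_mult algebraic_fps_const
        assms(5) D0)
  ultimately have "algebraic_fps (z * inverse ?D)" by (rule algebraic_fps_mult)
  also have "z * inverse ?D = ?G 0"
    unfolding z(3)[symmetric] using inverse_mult_eq_1'[OF D0] by (simp add: mult.assoc)
  also have "?G 0 = P_series S"
    by (simp add: P_series_def descent_series_def catalan_paths_eq_descents)
  finally show ?thesis .
qed

end
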